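(* Let $\{F_\alpha(z)\}$ be a family of formal power series in $\mathbb C[[z]]$ (indexed by complex weights $\alpha$ including all $\alpha=r+1/2$ with $r\ge0$ an integer) such that $F_\alpha$ is Möbius-covariant of weight $\alpha$, and put $f_m^{(r)}:=[z^m]F_{r+1/2}(z)$ for $m\ge0$. For integers $r\ge0$ and $0\le j\le r$ define $$\kappa_{r,j}^F:=\frac{1}{r+1/2}\,[z^r]\,F_{r+1/2}(z)\,A_C(z)\,U_C(z)^j,$$ with $U_C$ and $A_C$ the Catalan-type series defined in the context. Then, for every integer $r\ge 0$ and every $G(t)\in\mathbb C[[t]]$, $$\sum_{j=0}^r\kappa_{r,j}^F\,[t^j]G(t)=\frac{1}{r+1/2}[z^r]\,F_{r+1/2}(z)A_C(z)G(U_C(z))=\frac{1}{r+1/2}[z^r]\,F_{r+1/2}(-z)A_C(-z)G(-U_C(-z)).$$ The entries have the explicit form $$\kappa_{r,j}^F=\frac{1}{(r+1/2)4^r}\sum_{m=0}^{r-j}4^m\binom{2r-2m+1}{r-j-m}f_m^{(r)},$$ and $\kappa_{r,j}^F=0$ if $r+j$ is odd. If $F_{r+1/2}(0)\ne0$ for every $r\ge0$, then the lower-triangular array $(\kappa_{r,j}^F)_{r,j\ge0}$ (with zero entries for $j>r$) is nonsingular, with diagonal entries $$\kappa_{r,r}^F=\frac{F_{r+1/2}(0)}{(r+1/2)4^r};$$ thus, after separating even and odd indices, it defines two independent triangular transforms.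
   Context: $[z^r]H(z)$ denotes the coefficient of $z^r$ in the formal power series $H(z)$. For $\beta\in\mathbb C$, $(1-z)^\beta:=\sum_{k\ge0}\binom{\beta}{k}(-z)^k$. A series $F\in\mathbb C[[z]]$ is Möbius-covariant of weight $\alpha$ if $F\!\left(-\frac{z}{1-z}\right)=(1-z)^{-\alpha}F(z)$ in $\mathbb C[[z]]$. Let $C(z):=\frac{1-\sqrt{1-4z}}{2z}\in\mathbb C[[z]]$ be the Catalan generating series, and put $$U_C(z):=C(z/4)-1,\qquad A_C(z):=\frac{2-C(z/4)}{1-z}$$ as formal power series in $z$ ($U_C$ has zero constant term). *)

theory Defs
  imports Complex_Main "HOL-Computational_Algebra.Formal_Power_Series"
begin

definition one_minus_X_powr :: "complex \<Rightarrow> complex fps" where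
  "one_minus_X_powr \<beta> = Abs_fps (\<lambda>k. (\<beta> gchoose k) * (-1) ^ k)"

definition moebius_covariant :: "complex \<Rightarrow> complex fps \<Rightarrow> bool" where
  "moebius_covariant \<alpha> F \<longleftrightarrow>
     fps_compose F (- (fps_X / (1 - fps_X))) = one_minus_X_powr (- \<alpha>) * F"

text \<open>The numerator vanishes at \<open>0\<close>, so division by \<open>2z\<close> is exact (it shifts coefficients).\<close>

definition catalan_fps :: "complex fps" where
  "catalan_fps =
     (1 - fps_compose (one_minus_X_powr (1/2)) (fps_const 4 * fps_X)) / (fps_const 2 * fps_X)"

definition U_C :: "complex fps" where
  "U_C = fps_compose catalan_fps (fps_const (1/4) * fps_X) - 1"

definition A_C :: "complex fps" where
  "A_C = (2 - fps_compose catalan_fps (fps_const (1/4) * fps_X)) / (1 - fps_X)"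

text \<open>\<open>fps_compose G U\<close> is the substitution \<open>G(U(z))\<close> only if \<open>U\<close> has zero constant term.\<close>

lemma U_C_nth_0: "fps_nth U_C 0 = 0"
proof -
  define S where "S = fps_compose (one_minus_X_powr (1/2)) (fps_const 4 * fps_X)"
  have S: "fps_nth S k = ((1/2) gchoose k) * (-1) ^ k * 4 ^ k" for k
    unfolding S_def one_minus_X_powr_def by (simp only: fps_compose_linear) simp
  have "fps_const 2 * fps_X * fps_shift 1 (fps_const (1/2) * (1 - S)) = 1 - S"
    by (rule fps_ext) (simp add: S mult.assoc)
  then have "catalan_fps = fps_shift 1 (fps_const (1/2) * (1 - S))"
    unfolding catalan_fps_def S_def[symmetric]
    by (metis fps_X_neq_zero fps_const_eq_0_iff mult_eq_0_iff nonzero_mult_div_cancel_left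
        zero_neq_numeral)
  then have "fps_nth catalan_fps 0 = fps_nth (fps_shift 1 (fps_const (1/2) * (1 - S))) 0"
    by (rule arg_cong)
  also have "\<dots> = 1"
    by (simp add: S)
  finally have "fps_nth catalan_fps 0 = 1" .
  then show ?thesis
    by (simp add: U_C_def)
qed

definition half_weight :: "nat \<Rightarrow> complex" where
  "half_weight r = of_nat r + 1/2"

definition kappa :: "(complex \<Rightarrow> complex fps) \<Rightarrow> nat \<Rightarrow> nat \<Rightarrow> complex" where
  "kappa F r j = 1 / half_weight r * fps_nth (F (half_weight r) * A_C * U_C ^ j) r"

definition kappa_array :: "(complex \<Rightarrow> complex fps) \<Rightarrow> nat \<Rightarrow> nat \<Rightarrow> complex" where
  "kappa_array F r j = (if j \<le> r then kappa F r j else 0)"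

definition lower_triangular :: "(nat \<Rightarrow> nat \<Rightarrow> complex) \<Rightarrow> bool" where
  "lower_triangular a \<longleftrightarrow> (\<forall>i j. i < j \<longrightarrow> a i j = 0)"

text \<open>Row-by-column product of infinite arrays; row \<open>i\<close> of a lower-triangular \<open>a\<close> is supported
  on \<open>{..i}\<close>, so the truncated sum is the full one.\<close>

definition tri_mult ::
    "(nat \<Rightarrow> nat \<Rightarrow> complex) \<Rightarrow> (nat \<Rightarrow> nat \<Rightarrow> complex) \<Rightarrow> nat \<Rightarrow> nat \<Rightarrow> complex" where
  "tri_mult a b i k = (\<Sum>j\<le>i. a i j * b j k)"

definition tri_one :: "nat \<Rightarrow> nat \<Rightarrow> complex" where
  "tri_one i j = (if i = j then 1 else 0)"

text \<open>Nonsingularity of an infinite lower-triangular array: a two-sided inverse exists in the ring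
  of lower-triangular arrays.\<close>

definition tri_nonsingular :: "(nat \<Rightarrow> nat \<Rightarrow> complex) \<Rightarrow> bool" where
  "tri_nonsingular a \<longleftrightarrow>
     lower_triangular a \<and>
     (\<exists>b. lower_triangular b \<and> tri_mult a b = tri_one \<and> tri_mult b a = tri_one)"

definition tri_transform :: "(nat \<Rightarrow> nat \<Rightarrow> complex) \<Rightarrow> (nat \<Rightarrow> complex) \<Rightarrow> nat \<Rightarrow> complex" where
  "tri_transform a g r = (\<Sum>j\<le>r. a r j * g j)"

definition even_part :: "(nat \<Rightarrow> nat \<Rightarrow> complex) \<Rightarrow> nat \<Rightarrow> nat \<Rightarrow> complex" where
  "even_part a r j = a (2 * r) (2 * j)"

definition odd_part :: "(nat \<Rightarrow> nat \<Rightarrow> complex) \<Rightarrow> nat \<Rightarrow> nat \<Rightarrow> complex" where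
  "odd_part a r j = a (2 * r + 1) (2 * j + 1)"

end

theory Submission
  imports Defs
begin

text \<open>Let \<open>s\<close> be the square root of \<open>1 - z\<close> with constant term \<open>1\<close>. Then \<open>U_C = (1 - s) / (1 + s)\<close>
  and \<open>A_C = 2 / (s (1 + s))\<close>. The involution \<open>z \<mapsto> -z / (1 - z)\<close> sends \<open>s\<close> to \<open>1 / s\<close>, hence \<open>U_C\<close> to
  \<open>-U_C\<close> and \<open>A_C\<close> to \<open>s\<^sup>3 A_C\<close>. Performing this change of variable in the residue that computes
  the \<open>r\<close>-th coefficient of \<open>F A_C U_C^j\<close>, the covariance of \<open>F\<close> in weight \<open>r + 1/2\<close> cancels all
  powers of \<open>s\<close>, and the coefficient is multiplied by \<open>(-1)^(r+j)\<close>; so it vanishes if \<open>r + j\<close> is odd.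
  The explicit entries follow from \<open>z (1 + U_C)\<^sup>2 = 4 U_C\<close>, which on coefficients is Pascal's rule
  applied twice.\<close>

section \<open>Composition of power series and powers of \<open>1 - z\<close>\<close>

abbreviation sqrt_fps :: "complex fps" where
  "sqrt_fps \<equiv> one_minus_X_powr (1/2)"

abbreviation moebius_fps :: "complex fps" where
  "moebius_fps \<equiv> - (fps_X / (1 - fps_X))"

text \<open>As \<open>b\<close> has zero constant term, \<open>b ^ k\<close> starts in degree at
  least \<open>k\<close>. So all coefficients up to index \<open>n\<close> can be computed with the
  same range \<open>k \<le> n\<close>, and this uniform range lets the two sums be
  exchanged.\<close>

lemma fps_compose_mult_nth:
  fixes a b c :: "'a::comm_ring_1 fps"
  assumes "fps_nth b 0 = 0"
  shows "fps_nth (fps_compose a b * c) n = (\<Sum>k\<le>n. fps_nth a k * fps_nth (b ^ k * c) n)"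
proof -
  have "fps_nth (fps_compose a b) i = (\<Sum>k\<le>n. fps_nth a k * fps_nth (b ^ k) i)" if "i \<le> n" for i
    unfolding fps_compose_nth
    by (rule sum.mono_neutral_left)
       (use that assms in \<open>auto simp: startsby_zero_power_prefix\<close>)
  then have "fps_nth (fps_compose a b * c) n
      = (\<Sum>i=0..n. \<Sum>k\<le>n. fps_nth a k * (fps_nth (b ^ k) i * fps_nth c (n - i)))"
    by (simp add: fps_mult_nth sum_distrib_right mult.assoc)
  also have "\<dots> = (\<Sum>k\<le>n. fps_nth a k * fps_nth (b ^ k * c) n)"
    by (subst sum.swap) (simp add: fps_mult_nth sum_distrib_left)
  finally show ?thesis .
qed

lemma fps_compose_uminus_X_nth:
  "fps_nth (fps_compose a (- fps_X)) n = (-1) ^ n * fps_nth (a :: 'a::comm_ring_1 fps) n"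
  using fps_nth_compose_linear[of a "-1" n] by (simp flip: fps_const_neg)

lemma fps_const_neg_one_power: "fps_const ((-1) ^ n) = (-1 :: 'a::comm_ring_1 fps) ^ n"
  by (simp flip: fps_const_power fps_const_neg)

text \<open>Substituting \<open>- fps_X\<close> respects products, so the exponent laws of
  \<open>fps_binomial\<close> carry over to powers of \<open>1 - z\<close>.\<close>

lemma one_minus_X_powr_eq_compose: "one_minus_X_powr \<beta> = fps_compose (fps_binomial \<beta>) (- fps_X)"
proof -
  have "fps_compose (fps_binomial \<beta>) (fps_const (-1) * fps_X) = one_minus_X_powr \<beta>"
    by (rule fps_ext)
       (simp only: fps_nth_compose_linear, simp add: one_minus_X_powr_def)
  then show ?thesis by (simp flip: fps_const_neg)
qed

lemma one_minus_X_powr_add: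
  "one_minus_X_powr (a + b) = one_minus_X_powr a * one_minus_X_powr b"
  by (simp add: one_minus_X_powr_eq_compose fps_binomial_add_mult fps_compose_mult_distrib)

lemma one_minus_X_powr_0: "one_minus_X_powr 0 = 1"
  by (simp add: one_minus_X_powr_eq_compose)

lemma one_minus_X_powr_1: "one_minus_X_powr 1 = 1 - fps_X"
  by (simp add: one_minus_X_powr_eq_compose fps_binomial_1 fps_compose_add_distrib)

lemma one_minus_X_powr_of_nat_mult: "one_minus_X_powr (of_nat n * b) = one_minus_X_powr b ^ n"
  by (induction n) (simp_all add: one_minus_X_powr_0 one_minus_X_powr_add algebra_simps)

section \<open>The square root of \<open>1 - z\<close> and the Catalan series\<close>

lemma sqrt_fps_nth_0 [simp]: "fps_nth sqrt_fps 0 = 1"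
  by (simp add: one_minus_X_powr_def)

lemma sqrt_fps_square: "sqrt_fps ^ 2 = 1 - fps_X"
  using one_minus_X_powr_of_nat_mult[of 2 "1/2"] by (simp add: one_minus_X_powr_1)

lemma fps_X_eq_sqrt_fps: "fps_X = (1 - sqrt_fps) * (1 + sqrt_fps)"
  using sqrt_fps_square by (simp add: algebra_simps power2_eq_square)

lemma one_plus_sqrt_fps_nonzero: "1 + sqrt_fps \<noteq> 0"
proof
  assume "1 + sqrt_fps = 0"
  then have "fps_nth (1 + sqrt_fps) 0 = 0" by simp
  then show False by simp
qed

lemma sqrt_fps_nonzero: "sqrt_fps \<noteq> 0"
  using sqrt_fps_nth_0 by fastforce

text \<open>The definition gives \<open>C(z/4) = 2 (1 - s) / z\<close>, and
  \<open>z = (1 - s) (1 + s)\<close>. The product form avoids division of series.\<close>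

lemma catalan_quarter_times:
  "fps_compose catalan_fps (fps_const (1/4) * fps_X) * (1 + sqrt_fps) = 2"
proof -
  define S where "S = fps_compose sqrt_fps (fps_const 4 * fps_X)"
  have S0: "fps_nth S 0 = 1" by (simp add: S_def)
  \<comment> \<open>The numerator has zero constant term, so the division in
    \<open>catalan_fps\<close> is exact, with half the shifted numerator as quotient.\<close>
  have dvd: "fps_const 2 * fps_X dvd 1 - S"
  proof
    show "1 - S = fps_const 2 * fps_X * fps_shift 1 (fps_const (1/2) * (1 - S))"
      by (rule fps_ext) (simp add: S0 mult.assoc)
  qed
  have C: "catalan_fps * (fps_const 2 * fps_X) = 1 - S"
    unfolding catalan_fps_def S_def[symmetric] using dvd by (rule dvd_div_mult_self)
  let ?q = "fps_const (1/4) * fps_X :: complex fps"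
  let ?D = "fps_compose catalan_fps ?q"
  have Sq: "fps_compose S ?q = sqrt_fps"
    by (rule fps_ext) (simp add: S_def fps_compose_linear flip: power_mult_distrib)
  have "?D * (fps_const 2 * ?q) = 1 - sqrt_fps"
    using arg_cong[OF C, of "\<lambda>f. fps_compose f ?q"] Sq
    by (simp add: fps_compose_mult_distrib fps_compose_sub_distrib)
  also have "fps_const 2 * ?q = fps_const (1/2) * fps_X"
    by (simp flip: mult.assoc)
  finally have "2 * (?D * (fps_const (1/2) * fps_X)) = 2 * (1 - sqrt_fps)" by simp
  moreover have "2 * fps_const (1/2) = (1 :: complex fps)"
    by (simp add: numeral_fps_const)
  then have "2 * (?D * (fps_const (1/2) * fps_X)) = ?D * fps_X"
    by (metis mult.assoc mult.left_commute mult_1)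
  ultimately have "?D * fps_X = 2 * (1 - sqrt_fps)"
    by simp
  then have "(1 - sqrt_fps) * (?D * (1 + sqrt_fps)) = (1 - sqrt_fps) * 2"
    by (simp add: fps_X_eq_sqrt_fps algebra_simps)
  moreover have "1 - sqrt_fps \<noteq> 0"
    using fps_X_eq_sqrt_fps by force
  ultimately show ?thesis by (simp only: mult_cancel_left) simp
qed

lemma U_C_times: "U_C * (1 + sqrt_fps) = 1 - sqrt_fps"
  using catalan_quarter_times by (simp add: U_C_def algebra_simps)

text \<open>Since \<open>C(z/4) = 2 / (1 + s)\<close>, the numerator is
  \<open>2 s / (1 + s)\<close>; one factor \<open>s\<close> cancels against the denominator
  \<open>1 - z = s ^ 2\<close>.\<close>

lemma A_C_times: "A_C * (sqrt_fps * (1 + sqrt_fps)) = 2"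
proof -
  define D where "D = fps_compose catalan_fps (fps_const (1/4) * fps_X)"
  have "1 - fps_X dvd (2 - D)"
    by (rule dvd_trans[of _ 1]) (auto simp: fps_is_unit_iff)
  then have "A_C * sqrt_fps ^ 2 = 2 - D"
    unfolding A_C_def D_def[symmetric] sqrt_fps_square by (rule dvd_div_mult_self)
  then have "A_C * sqrt_fps ^ 2 * (1 + sqrt_fps) = 2 * (1 + sqrt_fps) - D * (1 + sqrt_fps)"
    by (simp only: left_diff_distrib)
  also have "\<dots> = sqrt_fps * 2"
    using catalan_quarter_times unfolding D_def by (simp add: algebra_simps)
  finally have "sqrt_fps * (A_C * (sqrt_fps * (1 + sqrt_fps))) = sqrt_fps * 2"
    by (simp add: power2_eq_square algebra_simps)
  then show ?thesis using sqrt_fps_nonzero by (simp only: mult_cancel_left) simp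
qed

section \<open>Coefficients of \<open>A_C * U_C ^ j\<close>\<close>

lemma U_C_quadratic: "fps_X * (1 + U_C) ^ 2 = 4 * U_C"
proof -
  define s u x where "s = sqrt_fps" and "u = U_C" and "x = (fps_X :: complex fps)"
  have "u * (1 + s) = 1 - s" "x = (1 - s) * (1 + s)" and nz: "1 + s \<noteq> 0"
    unfolding s_def u_def x_def
    by (fact U_C_times fps_X_eq_sqrt_fps one_plus_sqrt_fps_nonzero)+
  \<comment> \<open>The factor \<open>(1 + s) ^ 2\<close> clears the denominators of
    \<open>(1 + u) ^ 2\<close>, which leaves a polynomial consequence of the two relations.\<close>
  then have "(1 + s) ^ 2 * (x * (1 + u) ^ 2) = (1 + s) ^ 2 * (4 * u)"
    by algebra
  then show ?thesis
    using nz unfolding u_def x_def by (simp only: mult_cancel_left) simp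
qed

text \<open>This is the boundary case of the coefficient recurrence: multiplying
  \<open>U_C_quadratic\<close> by \<open>A_C * U_C ^ i\<close> only reaches exponents
  \<open>j = i + 1\<close>, so \<open>j = 0\<close> needs its own relation.\<close>

lemma A_C_recurrence: "4 * A_C = fps_X * (3 * A_C + A_C * U_C) + 4"
proof -
  define s u a x where "s = sqrt_fps" and "u = U_C" and "a = A_C" and "x = (fps_X :: complex fps)"
  have "u * (1 + s) = 1 - s" "a * (s * (1 + s)) = 2" "x = (1 - s) * (1 + s)"
    and nz: "1 + s \<noteq> 0" "s \<noteq> 0"
    unfolding s_def u_def a_def x_def
    by (fact U_C_times A_C_times fps_X_eq_sqrt_fps one_plus_sqrt_fps_nonzero sqrt_fps_nonzero)+
  then have "(s * (1 + s) ^ 2) * (4 * a) = (s * (1 + s) ^ 2) * (x * (3 * a + a * u) + 4)"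
    by algebra
  then show ?thesis
    using nz unfolding u_def a_def x_def by (simp only: mult_cancel_left) simp
qed

text \<open>The index \<open>j\<close> stays arbitrary in the induction because coefficient
  \<open>n + 1\<close> of column \<open>j\<close> is built from coefficient \<open>n\<close> of
  columns \<open>j - 1\<close>, \<open>j\<close> and \<open>j + 1\<close>. The factor
  \<open>4 ^ n\<close> clears the denominators.\<close>

lemma A_C_U_C_power_nth:
  "4 ^ n * fps_nth (A_C * U_C ^ j) n = (if j \<le> n then of_nat ((2 * n + 1) choose (n - j)) else 0)"
proof (induction n arbitrary: j)
  case 0
  have "4 * fps_nth A_C 0 = fps_nth (4 * A_C) 0"
    by (simp add: numeral_fps_const)
  also have "\<dots> = 4"
    by (subst A_C_recurrence) simp
  finally have "fps_nth A_C 0 = 1" by simp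
  then show ?case by (simp add: U_C_nth_0 power_0_left)
next
  case (Suc n)
  show ?case
  proof (cases j)
    case 0
    have "4 ^ Suc n * fps_nth A_C (Suc n) = 4 ^ n * fps_nth (4 * A_C) (Suc n)"
      by (simp add: numeral_fps_const)
    also have "\<dots> = 4 ^ n * fps_nth (3 * A_C + A_C * U_C) n"
      by (subst A_C_recurrence) (simp add: numeral_fps_const)
    also have "\<dots> = 3 * (4 ^ n * fps_nth (A_C * U_C ^ 0) n) + 4 ^ n * fps_nth (A_C * U_C ^ 1) n"
      by (simp add: numeral_fps_const algebra_simps)
    also have "\<dots> = of_nat (3 * ((2 * n + 1) choose n) +
        (if 1 \<le> n then (2 * n + 1) choose (n - 1) else 0))"
      unfolding Suc.IH by simp
    also have "3 * ((2 * n + 1) choose n) + (if 1 \<le> n then (2 * n + 1) choose (n - 1) else 0)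
        = (2 * Suc n + 1) choose Suc n"
    proof -
      \<comment> \<open>Pascal's rule twice yields lower indices \<open>n + 1\<close>,
        \<open>n\<close>, \<open>n - 1\<close> with weights 1, 2, 1; by symmetry the first two
        binomials agree, whence the weight 3.\<close>
      have "(2 * n + 1) choose (n + 1) = (2 * n + 1) choose n"
        using binomial_symmetric[of "n + 1" "2 * n + 1"] by simp
      then show ?thesis by (cases n) (simp_all add: numeral_eq_Suc)
    qed
    finally show ?thesis using 0 by simp
  next
    case (Suc i)
    have *: "4 * (A_C * U_C ^ Suc i)
        = fps_X * (A_C * U_C ^ i + 2 * (A_C * U_C ^ Suc i) + A_C * U_C ^ Suc (Suc i))"
    proof -
      define u a x c where "u = U_C" and "a = A_C" and "x = (fps_X :: complex fps)"
        and "c = U_C ^ i"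
      have "x * (1 + u) ^ 2 = 4 * u"
        unfolding u_def x_def by (rule U_C_quadratic)
      then have "4 * (a * (u * c)) = x * (a * c + 2 * (a * (u * c)) + a * (u * (u * c)))"
        by algebra
      then show ?thesis by (simp only: u_def a_def x_def c_def power_Suc)
    qed
    have "4 ^ Suc n * fps_nth (A_C * U_C ^ Suc i) (Suc n)
        = 4 ^ n * fps_nth (4 * (A_C * U_C ^ Suc i)) (Suc n)"
      by (simp add: numeral_fps_const)
    also have "\<dots> = 4 ^ n * fps_nth (A_C * U_C ^ i) n
        + 2 * (4 ^ n * fps_nth (A_C * U_C ^ Suc i) n)
        + 4 ^ n * fps_nth (A_C * U_C ^ Suc (Suc i)) n"
    proof -
      have "fps_nth (fps_X * (p + 2 * q + t)) (Suc n)
          = fps_nth p n + 2 * fps_nth q n + fps_nth t n" for p q t :: "complex fps"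
        by (simp add: numeral_fps_const)
      then show ?thesis unfolding * by (simp only:) (simp add: distrib_left mult.left_commute)
    qed
    also have "\<dots> = (if Suc i \<le> Suc n
        then of_nat ((2 * Suc n + 1) choose (Suc n - Suc i)) else 0)"
    proof -
      \<comment> \<open>In these cases none, one, two or all three of the terms on the left lie in
        the triangle.\<close>
      consider "n < i" | "n = i" | "n = Suc i" | k where "n = Suc (Suc (i + k))"
        using less_imp_Suc_add not_less_iff_gr_or_eq by (metis add_Suc_right Suc_lessI)
      then show ?thesis
        unfolding Suc.IH by cases (simp_all add: numeral_eq_Suc)
    qed
    finally show ?thesis using Suc by simp
  qed
qed

section \<open>The involution \<open>z \<mapsto> -z / (1 - z)\<close>\<close>

lemma moebius_fps_nth_0 [simp]: "fps_nth moebius_fps 0 = 0"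
  by simp

lemma moebius_fps_times: "moebius_fps * (1 - fps_X) = - fps_X"
proof -
  have "(1 - fps_X :: complex fps) dvd fps_X"
    by (rule dvd_trans[of _ 1]) (auto simp: fps_is_unit_iff)
  then show ?thesis by (simp add: dvd_div_mult_self)
qed

text \<open>The square of the left side is \<open>(1 - moebius_fps) * (1 - z) = 1\<close>, and the
  constant term 1 selects the sign.\<close>

lemma sqrt_fps_moebius: "fps_compose sqrt_fps moebius_fps * sqrt_fps = 1"
proof -
  let ?t = "fps_compose sqrt_fps moebius_fps * sqrt_fps"
  have "?t ^ 2 = fps_compose (sqrt_fps ^ 2) moebius_fps * sqrt_fps ^ 2"
    by (simp add: power_mult_distrib fps_compose_power)
  also have "\<dots> = (1 - moebius_fps) * (1 - fps_X)"
    by (simp add: sqrt_fps_square fps_compose_sub_distrib)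
  also have "\<dots> = 1"
    using moebius_fps_times by (simp add: algebra_simps)
  finally have "?t = 1 \<or> ?t = -1"
    by (simp only: power2_eq_1_iff)
  moreover have "fps_nth ?t 0 = 1" by simp
  ultimately show ?thesis by fastforce
qed

lemma U_C_moebius: "fps_compose U_C moebius_fps = - U_C"
proof -
  define s t u where "s = sqrt_fps" and "t = fps_compose sqrt_fps moebius_fps"
    and "u = fps_compose U_C moebius_fps"
  have ts: "t * s = 1" unfolding s_def t_def by (fact sqrt_fps_moebius)
  have u: "u * (1 + t) = 1 - t"
    using arg_cong[OF U_C_times, of "\<lambda>f. fps_compose f moebius_fps"]
    unfolding u_def t_def
    by (simp add: fps_compose_mult_distrib fps_compose_sub_distrib fps_compose_add_distrib)
  have "U_C * (1 + s) = 1 - s" and nz: "1 + s \<noteq> 0"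
    unfolding s_def by (fact U_C_times one_plus_sqrt_fps_nonzero)+
  then have "(1 + s) * (- U_C) = s - 1"
    by (simp only: mult_minus_right mult.commute[of "1 + s"] minus_diff_eq)
  \<comment> \<open>Since \<open>t * s = 1\<close>, the factor \<open>s\<close> turns
    \<open>1 + t\<close> into \<open>s + 1\<close> and \<open>1 - t\<close> into
    \<open>s - 1\<close>.\<close>
  moreover have "s * (u * (1 + t)) = s * (1 - t)"
    by (simp only: u)
  then have "(1 + s) * u = s - 1"
    using ts by algebra
  ultimately have "(1 + s) * u = (1 + s) * (- U_C)"
    by simp
  then show ?thesis using nz unfolding u_def by (simp only: mult_cancel_left) simp
qed

lemma A_C_moebius: "fps_compose A_C moebius_fps = A_C * sqrt_fps ^ 3"
proof -
  define s t a where "s = sqrt_fps" and "t = fps_compose sqrt_fps moebius_fps"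
    and "a = fps_compose A_C moebius_fps"
  have ts: "t * s = 1" unfolding s_def t_def by (fact sqrt_fps_moebius)
  have a: "a * (t * (1 + t)) = 2"
    using arg_cong[OF A_C_times, of "\<lambda>f. fps_compose f moebius_fps"]
    unfolding a_def t_def
    by (simp add: fps_compose_mult_distrib fps_compose_add_distrib numeral_fps_const)
  have A: "A_C * (s * (1 + s)) = 2" and nz: "1 + s \<noteq> 0"
    unfolding s_def by (fact A_C_times one_plus_sqrt_fps_nonzero)+
  have "(1 + s) * (A_C * s ^ 3) = s ^ 2 * (A_C * (s * (1 + s)))"
    by (simp only: power2_eq_square power3_eq_cube mult_ac)
  also have "\<dots> = s ^ 2 * 2"
    by (simp only: A)
  finally have "(1 + s) * (A_C * s ^ 3) = s ^ 2 * 2" .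
  \<comment> \<open>Here \<open>s ^ 2 * t * (1 + t) = s + 1\<close>, again by
    \<open>t * s = 1\<close>.\<close>
  moreover have "s ^ 2 * (a * (t * (1 + t))) = s ^ 2 * 2"
    by (simp only: a)
  then have "(1 + s) * a = s ^ 2 * 2"
    using ts by algebra
  ultimately have "(1 + s) * a = (1 + s) * (A_C * s ^ 3)"
    by simp
  then show ?thesis using nz unfolding a_def s_def by (simp only: mult_cancel_left) simp
qed

text \<open>Here \<open>K\<close> is \<open>(1 - z)^(r-1) H(-z / (1 - z))\<close>; the factor \<open>1 - z\<close> on the left keeps the exponent
  a natural number for \<open>r = 0\<close>.\<close>

lemma fps_nth_moebius_change:
  assumes K: "K * (1 - fps_X) = fps_compose H moebius_fps * (1 - fps_X) ^ r"
  shows "fps_nth K r = (-1) ^ r * fps_nth H r"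
proof -
  define E :: "complex fps" where "E = inverse (1 - fps_X)"
  have E: "E * (1 - fps_X) = 1"
    unfolding E_def by (rule inverse_mult_eq_1) simp
  have "K = K * (1 - fps_X) * E" using E by (simp add: mult_ac)
  then have KE: "K = fps_compose H moebius_fps * ((1 - fps_X) ^ r * E)"
    by (simp add: K mult_ac)
  have m: "moebius_fps = - fps_X * E"
  proof -
    have "(1 - fps_X) * E = 1" using E by (simp only: mult.commute)
    then have "moebius_fps = moebius_fps * (1 - fps_X) * E" by (simp only: mult.assoc mult_1_right)
    then show ?thesis by (simp only: moebius_fps_times)
  qed
  have EQ: "E ^ k * (1 - fps_X) ^ k = 1" for k
    using E by (simp flip: power_mult_distrib)
  \<comment> \<open>The series is \<open>(-z)^k (1 - z)^(r-1-k)\<close>. For \<open>k < r\<close> it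
    is a polynomial of degree \<open>r - 1\<close>, so its coefficient at \<open>r\<close> vanishes;
    for \<open>k = r\<close> it is \<open>(-z)^r / (1 - z)\<close>.\<close>
  have summand: "fps_nth (moebius_fps ^ k * ((1 - fps_X) ^ r * E)) r = (if k = r then (-1) ^ r else 0)"
    if "k \<le> r" for k
  proof -
    obtain d where d: "r = k + d" using le_Suc_ex[OF \<open>k \<le> r\<close>] by blast
    have "moebius_fps ^ k * ((1 - fps_X) ^ r * E)
        = fps_X ^ k * ((-1) ^ k * ((E ^ k * (1 - fps_X) ^ k) * ((1 - fps_X) ^ d * E)))"
      unfolding m d by (simp only: power_add power_mult_distrib power_minus[of fps_X] mult_ac)
    also have "\<dots> = fps_X ^ k * (fps_const ((-1) ^ k) * ((1 - fps_X) ^ d * E))"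
      by (simp only: EQ mult_1 fps_const_neg_one_power)
    finally have *: "fps_nth (moebius_fps ^ k * ((1 - fps_X) ^ r * E)) r
        = (-1) ^ k * fps_nth ((1 - fps_X) ^ d * E) d"
      by (simp only:) (simp add: d fps_X_power_mult_nth)
    have "fps_nth ((1 - fps_X) ^ d * E) d = (if d = 0 then 1 else 0)"
    proof (cases d)
      case 0
      then show ?thesis by (simp add: E_def)
    next
      case (Suc e)
      have "(1 - fps_X) ^ d * E = (1 - fps_X) ^ e * (E * (1 - fps_X))"
        unfolding Suc by (simp only: power_Suc mult_ac)
      also have "\<dots> = one_minus_X_powr (of_nat e)"
        using one_minus_X_powr_of_nat_mult[of e 1] by (simp add: E one_minus_X_powr_1)
      finally have "fps_nth ((1 - fps_X) ^ d * E) d = (of_nat e gchoose d) * (-1) ^ d"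
        by (simp add: one_minus_X_powr_def)
      also have "(of_nat e gchoose d :: complex) = 0"
        using Suc by (simp add: gbinomial_of_nat_symmetric flip: binomial_gbinomial)
      finally show ?thesis using Suc by simp
    qed
    then show ?thesis using * d by auto
  qed
  have "fps_nth K r = (\<Sum>k=0..r. fps_nth H k * fps_nth (moebius_fps ^ k * ((1 - fps_X) ^ r * E)) r)"
    unfolding KE by (subst fps_compose_mult_nth) (simp_all add: atMost_atLeast0)
  also have "\<dots> = (\<Sum>k=0..r. if k = r then fps_nth H r * (-1) ^ r else 0)"
    by (intro sum.cong refl) (simp add: summand)
  finally show ?thesis by simp
qed

section \<open>Generating identities, explicit form and parity of \<open>kappa\<close>\<close>

lemma half_weight_nonzero: "half_weight r \<noteq> 0"
proof
  assume "half_weight r = 0"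
  then have "Re (half_weight r) = 0" by simp
  then show False by (simp add: half_weight_def)
qed

lemma kappa_generating:
  "(\<Sum>j\<le>r. kappa F r j * fps_nth G j)
    = 1 / half_weight r * fps_nth (F (half_weight r) * A_C * fps_compose G U_C) r"
proof -
  have "fps_nth (F (half_weight r) * A_C * fps_compose G U_C) r
      = fps_nth (fps_compose G U_C * (F (half_weight r) * A_C)) r"
    by (simp add: mult_ac)
  also have "\<dots> = (\<Sum>j\<le>r. fps_nth G j * fps_nth (U_C ^ j * (F (half_weight r) * A_C)) r)"
    by (rule fps_compose_mult_nth) (rule U_C_nth_0)
  finally show ?thesis
    by (simp add: kappa_def sum_distrib_left mult_ac)
qed

text \<open>Reflecting \<open>z\<close> to \<open>-z\<close> contributes \<open>(-1) ^ r\<close> to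
  the coefficient, and the outer sign of \<open>-U_C(-z)\<close> contributes
  \<open>(-1) ^ j\<close>. These signs disappear once the entries with \<open>r + j\<close> odd are
  known to vanish.\<close>

lemma kappa_generating_reflected:
  "(\<Sum>j\<le>r. (-1) ^ (r + j) * kappa F r j * fps_nth G j)
    = 1 / half_weight r *
        fps_nth (fps_compose (F (half_weight r)) (- fps_X) * fps_compose A_C (- fps_X)
                   * fps_compose G (- fps_compose U_C (- fps_X))) r"
proof -
  let ?refl = "\<lambda>f :: complex fps. fps_compose f (- fps_X)"
  let ?H = "\<lambda>j. F (half_weight r) * A_C * U_C ^ j"
  have reflect: "(- ?refl U_C) ^ j * (?refl (F (half_weight r)) * ?refl A_C)
      = fps_const ((-1) ^ j) * ?refl (?H j)" for j
    by (simp add: fps_compose_mult_distrib fps_compose_power power_minus[of "fps_compose U_C _"]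
        mult_ac flip: fps_const_power fps_const_neg)
  have "fps_nth (?refl (F (half_weight r)) * ?refl A_C * fps_compose G (- ?refl U_C)) r
      = fps_nth (fps_compose G (- ?refl U_C) * (?refl (F (half_weight r)) * ?refl A_C)) r"
    by (simp add: mult_ac)
  also have "\<dots> = (\<Sum>j\<le>r. fps_nth G j *
      fps_nth ((- ?refl U_C) ^ j * (?refl (F (half_weight r)) * ?refl A_C)) r)"
    by (rule fps_compose_mult_nth) (simp add: U_C_nth_0)
  also have "\<dots> = (\<Sum>j\<le>r. fps_nth G j * ((-1) ^ (r + j) * fps_nth (?H j) r))"
    unfolding reflect
    by (simp only: fps_mult_left_const_nth fps_compose_uminus_X_nth power_add mult_ac)
  finally show ?thesis
    by (simp add: kappa_def sum_distrib_left mult_ac)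
qed

text \<open>In the Cauchy product, \<open>4 ^ r\<close> splits as
  \<open>4 ^ m * 4 ^ (r - m)\<close>; the second factor is the one in
  \<open>A_C_U_C_power_nth\<close>. Terms with \<open>m > r - j\<close> vanish.\<close>

lemma kappa_explicit:
  assumes "j \<le> r"
  shows "kappa F r j = 1 / (half_weight r * 4 ^ r) *
    (\<Sum>m = 0..r - j. 4 ^ m * of_nat ((2 * r - 2 * m + 1) choose (r - j - m))
                     * fps_nth (F (half_weight r)) m)"
proof -
  let ?f = "fps_nth (F (half_weight r))"
  have coeff: "4 ^ r * fps_nth (A_C * U_C ^ j) (r - m)
      = (if j \<le> r - m then 4 ^ m * of_nat ((2 * r - 2 * m + 1) choose (r - j - m)) else 0)"
    if "m \<le> r" for m
  proof -
    have "(4 :: complex) ^ r = 4 ^ m * 4 ^ (r - m)"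
      using that by (simp flip: power_add)
    then have "4 ^ r * fps_nth (A_C * U_C ^ j) (r - m)
        = 4 ^ m * (4 ^ (r - m) * fps_nth (A_C * U_C ^ j) (r - m))"
      by (simp only: mult.assoc)
    moreover have "2 * (r - m) + 1 = 2 * r - 2 * m + 1" "r - m - j = r - j - m"
      using that by auto
    ultimately show ?thesis by (simp only: A_C_U_C_power_nth) simp
  qed
  have "4 ^ r * fps_nth (F (half_weight r) * A_C * U_C ^ j) r
      = (\<Sum>m=0..r. 4 ^ r * fps_nth (A_C * U_C ^ j) (r - m) * ?f m)"
    unfolding mult.assoc[of "F (half_weight r)"] fps_mult_nth[of "F (half_weight r)"] sum_distrib_left
    by (intro sum.cong refl) (simp only: mult_ac)
  also have "\<dots> = (\<Sum>m=0..r. (if j \<le> r - m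
      then 4 ^ m * of_nat ((2 * r - 2 * m + 1) choose (r - j - m)) else 0) * ?f m)"
    by (intro sum.cong refl) (simp only: coeff atLeastAtMost_iff)
  also have "\<dots> = (\<Sum>m=0..r - j. 4 ^ m * of_nat ((2 * r - 2 * m + 1) choose (r - j - m)) * ?f m)"
    by (rule sum.mono_neutral_cong_right) (use assms in auto)
  finally show ?thesis
    using half_weight_nonzero[of r] by (simp add: kappa_def field_simps)
qed

lemma kappa_odd:
  assumes cov: "moebius_covariant (half_weight r) (F (half_weight r))" and "odd (r + j)"
  shows "kappa F r j = 0"
proof -
  let ?H = "F (half_weight r) * A_C * U_C ^ j"
  have "half_weight r = of_nat (2 * r + 1) * (1/2)"
    by (simp add: half_weight_def field_simps)
  then have weight: "one_minus_X_powr (- half_weight r) * sqrt_fps ^ (2 * r + 1) = 1"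
    by (metis add.left_inverse one_minus_X_powr_0 one_minus_X_powr_add one_minus_X_powr_of_nat_mult)
  have F: "fps_compose (F (half_weight r)) moebius_fps
      = one_minus_X_powr (- half_weight r) * F (half_weight r)"
    using cov by (simp only: moebius_covariant_def)
  have "(1 - fps_X) ^ r = sqrt_fps ^ (2 * r)"
    by (simp only: power_mult sqrt_fps_square)
  moreover have "fps_compose ?H moebius_fps
      = (one_minus_X_powr (- half_weight r) * F (half_weight r)) * (A_C * sqrt_fps ^ 3) * (- U_C) ^ j"
    by (simp only: fps_compose_mult_distrib[OF moebius_fps_nth_0] F A_C_moebius U_C_moebius
        fps_compose_power[OF moebius_fps_nth_0, symmetric])
  ultimately have "fps_compose ?H moebius_fps * (1 - fps_X) ^ r
      = (one_minus_X_powr (- half_weight r) * F (half_weight r)) * (A_C * sqrt_fps ^ 3)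
          * (- U_C) ^ j * sqrt_fps ^ (2 * r)"
    by (simp only:)
  \<comment> \<open>The exponent of \<open>s\<close> is \<open>3 + 2 r = (2 r + 1) + 2\<close>: the
    power \<open>2 r + 1\<close> cancels the covariance factor, and the remaining
    \<open>s ^ 2\<close> is the factor \<open>1 - z\<close> that
    \<open>fps_nth_moebius_change\<close> expects.\<close>
  also have "\<dots> = (one_minus_X_powr (- half_weight r) * sqrt_fps ^ (2 * r + 1))
      * (F (half_weight r) * A_C * (- U_C) ^ j) * sqrt_fps ^ 2"
    by (simp add: power_add power2_eq_square power3_eq_cube mult_ac)
  also have "\<dots> = (fps_const ((-1) ^ j) * ?H) * (1 - fps_X)"
    unfolding weight sqrt_fps_square
    by (simp add: power_minus[of U_C] mult_ac flip: fps_const_power fps_const_neg)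
  \<comment> \<open>The series \<open>K\<close> is here \<open>(-1) ^ j\<close> times
    \<open>?H\<close> itself, so the same coefficient carries both signs.\<close>
  finally have "fps_nth (fps_const ((-1) ^ j) * ?H) r = (-1) ^ r * fps_nth ?H r"
    by (intro fps_nth_moebius_change) simp
  then have "((-1) ^ j - (-1) ^ r) * fps_nth ?H r = 0"
    by (simp only: fps_mult_left_const_nth left_diff_distrib diff_self)
  moreover have "(-1) ^ j - (-1) ^ r \<noteq> (0 :: complex)"
    using assms(2) by (cases "even j") auto
  ultimately show ?thesis by (simp add: kappa_def)
qed

section \<open>The ring of lower-triangular arrays\<close>

lemma tri_mult_assoc:
  assumes "lower_triangular a" "lower_triangular b"
  shows "tri_mult (tri_mult a b) c = tri_mult a (tri_mult b c)"
proof (intro ext)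
  fix i k
  have "tri_mult (tri_mult a b) c i k = (\<Sum>j\<le>i. \<Sum>l\<le>i. a i l * b l j * c j k)"
    by (simp add: tri_mult_def sum_distrib_right)
  also have "\<dots> = (\<Sum>l\<le>i. \<Sum>j\<le>i. a i l * b l j * c j k)"
    by (rule sum.swap)
  \<comment> \<open>Triangularity of \<open>b\<close> cuts the inner range to
    \<open>j \<le> l\<close>, the truncation used in \<open>tri_mult b c\<close>.\<close>
  also have "\<dots> = (\<Sum>l\<le>i. \<Sum>j\<le>l. a i l * b l j * c j k)"
    using assms(2)
    by (intro sum.cong refl sum.mono_neutral_right) (auto simp: lower_triangular_def)
  finally show "tri_mult (tri_mult a b) c i k = tri_mult a (tri_mult b c) i k"
    by (simp add: tri_mult_def sum_distrib_left mult.assoc)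
qed

lemma tri_mult_one_left: "tri_mult tri_one a = a"
  by (intro ext) (simp add: tri_mult_def tri_one_def if_distrib[of "\<lambda>x. x * _"] cong: if_cong)

lemma tri_mult_one_right: "lower_triangular a \<Longrightarrow> tri_mult a tri_one = a"
  by (intro ext)
     (auto simp: tri_mult_def tri_one_def lower_triangular_def if_distrib[of "\<lambda>x. _ * x"]
       cong: if_cong)

text \<open>Forward substitution: row \<open>i\<close> of the equation \<open>a b = 1\<close> is
  solved for \<open>b i k\<close> from the earlier rows.\<close>

function tri_inverse :: "(nat \<Rightarrow> nat \<Rightarrow> complex) \<Rightarrow> nat \<Rightarrow> nat \<Rightarrow> complex" where
  "tri_inverse a i k = (tri_one i k - (\<Sum>j<i. a i j * tri_inverse a j k)) / a i i"
  by pat_completeness auto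
termination by (relation "measure (\<lambda>(a, i, k). i)") auto

declare tri_inverse.simps [simp del]

lemma lower_triangular_tri_inverse: "lower_triangular (tri_inverse a)"
proof -
  have "i < k \<Longrightarrow> tri_inverse a i k = 0" for i k
    by (induction i rule: less_induct) (subst tri_inverse.simps, simp add: tri_one_def)
  then show ?thesis by (simp add: lower_triangular_def)
qed

lemma tri_mult_tri_inverse:
  assumes "\<And>i. a i i \<noteq> 0"
  shows "tri_mult a (tri_inverse a) = tri_one"
proof (intro ext)
  fix i k
  have "tri_mult a (tri_inverse a) i k
      = (\<Sum>j<i. a i j * tri_inverse a j k) + a i i * tri_inverse a i k"
    by (simp add: tri_mult_def flip: lessThan_Suc_atMost)
  also have "\<dots> = tri_one i k"
    by (subst (2) tri_inverse.simps) (simp add: assms)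
  finally show "tri_mult a (tri_inverse a) i k = tri_one i k" .
qed

text \<open>Forward substitution only gives right inverses. Applying it again to \<open>b\<close>
  gives \<open>c\<close> with \<open>b c = 1\<close>, and then
  \<open>c = (a b) c = a (b c) = a\<close>, so \<open>b\<close> is also a left inverse.\<close>

lemma tri_nonsingularI:
  assumes a: "lower_triangular a" and diag: "\<And>i. a i i \<noteq> 0"
  shows "tri_nonsingular a"
proof -
  define b where "b = tri_inverse a"
  define c where "c = tri_inverse b"
  have b: "lower_triangular b" unfolding b_def by (rule lower_triangular_tri_inverse)
  have ab: "tri_mult a b = tri_one" unfolding b_def using diag by (rule tri_mult_tri_inverse)
  have "b i i \<noteq> 0" for i
  proof -
    \<comment> \<open>Hence \<open>b i i = 1 / a i i\<close>, which allows the second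
      substitution.\<close>
    have "(\<Sum>j<i. a i j * b j i) = 0"
      using b by (simp add: lower_triangular_def)
    then show ?thesis
      unfolding b_def by (subst tri_inverse.simps) (simp add: diag tri_one_def)
  qed
  then have bc: "tri_mult b c = tri_one" unfolding c_def by (rule tri_mult_tri_inverse)
  have "c = a"
    using tri_mult_assoc[OF a b, of c] a ab bc
    by (simp add: tri_mult_one_left tri_mult_one_right)
  then show ?thesis
    using a b ab bc by (auto simp: tri_nonsingular_def)
qed

section \<open>Separation of parities and the final result\<close>

lemma sum_even_support:
  fixes h :: "nat \<Rightarrow> 'a::comm_monoid_add"
  assumes "\<And>j. odd j \<Longrightarrow> h j = 0"
  shows "(\<Sum>j\<le>2 * r. h j) = (\<Sum>j\<le>r. h (2 * j))"
  by (induction r) (simp_all add: assms)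

lemma sum_odd_support:
  fixes h :: "nat \<Rightarrow> 'a::comm_monoid_add"
  assumes "\<And>j. even j \<Longrightarrow> h j = 0"
  shows "(\<Sum>j\<le>2 * r + 1. h j) = (\<Sum>j\<le>r. h (2 * j + 1))"
  by (induction r) (simp_all add: assms)

theorem corollary3p1:
  fixes I :: "complex set" and F :: "complex \<Rightarrow> complex fps"
  assumes half_weights: "\<And>r. half_weight r \<in> I"
    and covariant: "\<And>\<alpha>. \<alpha> \<in> I \<Longrightarrow> moebius_covariant \<alpha> (F \<alpha>)"
  shows
    "(\<forall>r. \<forall>G :: complex fps.
        (\<Sum>j\<le>r. kappa F r j * fps_nth G j)
          = 1 / half_weight r *
              fps_nth (F (half_weight r) * A_C * fps_compose G U_C) r
        \<and> 1 / half_weight r *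
              fps_nth (F (half_weight r) * A_C * fps_compose G U_C) r
          = 1 / half_weight r *
              fps_nth (fps_compose (F (half_weight r)) (- fps_X) * fps_compose A_C (- fps_X)
                         * fps_compose G (- fps_compose U_C (- fps_X))) r)
     \<and> (\<forall>r. \<forall>j\<le>r.
          kappa F r j
            = 1 / (half_weight r * 4 ^ r) *
                (\<Sum>m = 0..r - j. 4 ^ m * of_nat ((2 * r - 2 * m + 1) choose (r - j - m))
                                 * fps_nth (F (half_weight r)) m))
     \<and> (\<forall>r. \<forall>j\<le>r. odd (r + j) \<longrightarrow> kappa F r j = 0)
     \<and> ((\<forall>r. fps_nth (F (half_weight r)) 0 \<noteq> 0) \<longrightarrow>
          tri_nonsingular (kappa_array F)
          \<and> (\<forall>r. kappa_array F r r = fps_nth (F (half_weight r)) 0 / (half_weight r * 4 ^ r))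
          \<and> tri_nonsingular (even_part (kappa_array F))
          \<and> tri_nonsingular (odd_part (kappa_array F))
          \<and> (\<forall>g r. tri_transform (kappa_array F) g (2 * r)
                    = tri_transform (even_part (kappa_array F)) (\<lambda>j. g (2 * j)) r)
          \<and> (\<forall>g r. tri_transform (kappa_array F) g (2 * r + 1)
                    = tri_transform (odd_part (kappa_array F)) (\<lambda>j. g (2 * j + 1)) r))"
proof -
  have kappa_odd_F: "kappa F r j = 0" if "odd (r + j)" for r j
    using covariant[OF half_weights] that by (rule kappa_odd)
  show ?thesis
  proof (intro conjI allI impI)
    fix r and G :: "complex fps"
    show "(\<Sum>j\<le>r. kappa F r j * fps_nth G j)
        = 1 / half_weight r * fps_nth (F (half_weight r) * A_C * fps_compose G U_C) r"
      by (rule kappa_generating)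
    show "1 / half_weight r * fps_nth (F (half_weight r) * A_C * fps_compose G U_C) r
        = 1 / half_weight r *
            fps_nth (fps_compose (F (half_weight r)) (- fps_X) * fps_compose A_C (- fps_X)
                       * fps_compose G (- fps_compose U_C (- fps_X))) r"
    proof -
      \<comment> \<open>The sign is 1 when \<open>r + j\<close> is even, and the entry is 0
        otherwise.\<close>
      have "(-1) ^ (r + j) * kappa F r j = kappa F r j" for j
        using kappa_odd_F[of r j]
        by (cases "even (r + j)") (simp_all only: neg_one_even_power mult_1 mult_zero_right simp_thms)
      then show ?thesis
        unfolding kappa_generating[symmetric] kappa_generating_reflected[symmetric] by (simp only:)
    qed
  next
    fix r j :: nat assume "j \<le> r"
    then show "kappa F r j = 1 / (half_weight r * 4 ^ r) *
        (\<Sum>m = 0..r - j. 4 ^ m * of_nat ((2 * r - 2 * m + 1) choose (r - j - m))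
                         * fps_nth (F (half_weight r)) m)"
      by (rule kappa_explicit)
  next
    fix r j :: nat assume "odd (r + j)"
    then show "kappa F r j = 0" by (rule kappa_odd_F)
  next
    assume nz: "\<forall>r. fps_nth (F (half_weight r)) 0 \<noteq> 0"
    let ?a = "kappa_array F"
    have lower: "lower_triangular ?a" by (simp add: lower_triangular_def kappa_array_def)
    \<comment> \<open>For \<open>j = r\<close> only \<open>m = 0\<close> remains, with binomial
      coefficient 1.\<close>
    have diag: "?a r r = fps_nth (F (half_weight r)) 0 / (half_weight r * 4 ^ r)" for r
      by (simp add: kappa_array_def kappa_explicit)
    then have diag_nz: "?a r r \<noteq> 0" for r
      using nz half_weight_nonzero by simp
    have odd_zero: "?a r j = 0" if "odd (r + j)" for r j
      using kappa_odd_F[OF that] by (simp add: kappa_array_def)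
    show "tri_nonsingular ?a"
      using lower diag_nz by (rule tri_nonsingularI)
    show "?a r r = fps_nth (F (half_weight r)) 0 / (half_weight r * 4 ^ r)" for r
      by (rule diag)
    show "tri_nonsingular (even_part ?a)"
      using lower diag_nz by (intro tri_nonsingularI) (auto simp: lower_triangular_def even_part_def)
    show "tri_nonsingular (odd_part ?a)"
      using lower diag_nz[of "2 * _ + 1"]
      by (intro tri_nonsingularI) (auto simp: lower_triangular_def odd_part_def)
    \<comment> \<open>Row \<open>2 * r\<close> is supported on even columns, so only the
      even-indexed values of \<open>g\<close> enter; odd rows behave likewise.\<close>
    show "tri_transform ?a g (2 * r) = tri_transform (even_part ?a) (\<lambda>j. g (2 * j)) r" for g r
      unfolding tri_transform_def even_part_def
      by (rule sum_even_support) (simp add: odd_zero)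
    show "tri_transform ?a g (2 * r + 1) = tri_transform (odd_part ?a) (\<lambda>j. g (2 * j + 1)) r" for g r
      unfolding tri_transform_def odd_part_def
      by (rule sum_odd_support) (simp add: odd_zero)
  qed
qed

end
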